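(* Let $h:\mathbb{R}^n\to\overline{\mathbb{R}}$ be a proper, lower semicontinuous, and $(\kappa,\gamma)$-strongly quasar-convex function with respect to some $\overline{x}\in\arg\min_{\mathbb{R}^n}h$, for $\kappa\in(0,1]$ and $\gamma\ge 0$. Assume that $0<\beta'\le\beta_k\le\beta''$ for all $k\in\mathbb{N}_0$. Let $\{x^k\}_{k\in\mathbb{N}_0}$ be generated by HiPPA with $p>1$. Then the following assertions hold: (a) The sequence $\{h(x^k)\}_{k\in\mathbb{N}_0}$ is decreasing. (b) $\sum_{k=0}^\infty\|x^{k+1}-x^k\|^p<\infty$. (c) The sequence $\{x^k\}_{k\in\mathbb{N}_0}$ is bounded and the sequence $\{\|x^k-\overline{x}\|\}_{k\in\mathbb{N}_0}$ is nonincreasing. (d) The sequence $\{h(x^k)\}_{k\in\mathbb{N}_0}$ converges to $\min_{x\in\mathbb{R}^n}h(x)$. (e) Every cluster point of $\{x^k\}_{k\in\mathbb{N}_0}$ belongs to $\arg\min_{\mathbb{R}^n}h$. (f) If $\gamma=0$ and $h$ is $\kappa$-quasar-convex with respect to every $\overline{x}\in\arg\min_{\mathbb{R}^n}h$, then $\{x^k\}_{k\in\mathbb{N}_0}$ converges to a point in $\arg\min_{\mathbb{R}^n}h$. (g) If $\gamma>0$, then $\{x^k\}_{k\in\mathbb{N}_0}$ converges to $\overline{x}$, where $\{\overline{x}\}=\arg\min_{\mathbb{R}^n}h$.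
   Context: $\overline{\mathbb{R}}=\mathbb{R}\cup\{+\infty\}$; $\mathrm{dom}(h)=\{x:h(x)<+\infty\}$; $h$ is proper if $\mathrm{dom}(h)\neq\emptyset$; $\|\cdot\|$ is the Euclidean norm; $\mathbb{N}_0=\mathbb{N}\cup\{0\}$. Let $\kappa\in(0,1]$, $\gamma\ge 0$. A proper function $h:\mathbb{R}^n\to\overline{\mathbb{R}}$ with convex domain and $\arg\min_{\mathbb{R}^n}h\neq\emptyset$ is called $(\kappa,\gamma)$-strongly quasar-convex with respect to $\overline{x}\in\arg\min_{\mathbb{R}^n}h$ if for all $x\in\mathrm{dom}(h)$ and all $\lambda\in[0,1]$, $$h(\lambda\overline{x}+(1-\lambda)x)\le\kappa\lambda h(\overline{x})+(1-\kappa\lambda)h(x)-\lambda\left(1-\frac{\lambda}{2-\kappa}\right)\frac{\kappa\gamma}{2}\|x-\overline{x}\|^2.$$ If $\gamma=0$, $h$ is called $\kappa$-quasar-convex with respect to $\overline{x}$. For $p>1$, $\beta>0$: $\mathrm{Prox}^p_{\beta h}(x):=\arg\min_{y\in\mathbb{R}^n}\{h(y)+\frac{1}{p\beta}\|x-y\|^p\}$ (set-valued). HiPPA (high-order proximal-point algorithm): given $x^0\in\mathbb{R}^n$, $p>1$ and parameters $\{\beta_k\}_{k\in\mathbb{N}_0}\subseteq(0,+\infty)$, at iteration $k=0,1,2,\dots$ choose $x^{k+1}\in\mathrm{Prox}^p_{\beta_kh}(x^k)$; if $x^{k+1}=x^k$ stop, otherwise continue with $k+1$ (so an infinite generated sequence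 has $x^{k+1}\ne x^k$ for all $k$). *)

theory Defs
  imports "HOL-Analysis.Analysis"
begin

text \<open>Functions into \<open>\<real> \<union> {+\<infinity>}\<close> are modelled as \<^typ>\<open>ereal\<close>-valued functions that
  never take the value \<open>-\<infinity>\<close>; this restriction is part of \<open>proper\<close>.\<close>

definition edom :: "('a \<Rightarrow> ereal) \<Rightarrow> 'a set" where
  "edom h = {x. h x < \<infinity>}"

definition proper :: "('a \<Rightarrow> ereal) \<Rightarrow> bool" where
  "proper h \<longleftrightarrow> (\<forall>x. h x \<noteq> -\<infinity>) \<and> edom h \<noteq> {}"

definition argmin :: "('a \<Rightarrow> ereal) \<Rightarrow> 'a set" where
  "argmin h = {x. is_arg_min h (\<lambda>_. True) x}"

definition lsc :: "('a::topological_space \<Rightarrow> ereal) \<Rightarrow> bool" where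
  "lsc h \<longleftrightarrow> (\<forall>x. h x \<le> Liminf (at x) h)"

text \<open>For \<open>x\<close> in the domain, \<open>h xbar\<close> and \<open>h x\<close> are finite by properness, so the right-hand
  side of the inequality never involves a product or difference of infinities.\<close>

definition strongly_quasar_convex ::
    "real \<Rightarrow> real \<Rightarrow> ('a::euclidean_space \<Rightarrow> ereal) \<Rightarrow> 'a \<Rightarrow> bool" where
  "strongly_quasar_convex \<kappa> \<gamma> h xbar \<longleftrightarrow>
     0 < \<kappa> \<and> \<kappa> \<le> 1 \<and> 0 \<le> \<gamma> \<and>
     proper h \<and> convex (edom h) \<and> xbar \<in> argmin h \<and>
     (\<forall>x \<in> edom h. \<forall>l \<in> {0..1}.
        h (l *\<^sub>R xbar + (1 - l) *\<^sub>R x)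
          \<le> ereal (\<kappa> * l) * h xbar + ereal (1 - \<kappa> * l) * h x
            - ereal (l * (1 - l / (2 - \<kappa>)) * (\<kappa> * \<gamma> / 2) * (norm (x - xbar))\<^sup>2))"

definition quasar_convex :: "real \<Rightarrow> ('a::euclidean_space \<Rightarrow> ereal) \<Rightarrow> 'a \<Rightarrow> bool" where
  "quasar_convex \<kappa> h xbar \<longleftrightarrow> strongly_quasar_convex \<kappa> 0 h xbar"

definition Prox :: "real \<Rightarrow> real \<Rightarrow> ('a::euclidean_space \<Rightarrow> ereal) \<Rightarrow> 'a \<Rightarrow> 'a set" where
  "Prox p b h x = argmin (\<lambda>y. h y + ereal (1 / (p * b) * norm (x - y) powr p))"

text \<open>An infinite run of the high-order proximal-point algorithm: the stopping test
  \<open>x (Suc k) = x k\<close> never succeeds.\<close>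

definition HiPPA ::
    "real \<Rightarrow> (nat \<Rightarrow> real) \<Rightarrow> ('a::euclidean_space \<Rightarrow> ereal) \<Rightarrow> (nat \<Rightarrow> 'a) \<Rightarrow> bool" where
  "HiPPA p \<beta> h x \<longleftrightarrow> (\<forall>k. x (Suc k) \<in> Prox p (\<beta> k) h (x k) \<and> x (Suc k) \<noteq> x k)"

definition cluster_point :: "(nat \<Rightarrow> 'a::topological_space) \<Rightarrow> 'a \<Rightarrow> bool" where
  "cluster_point x z \<longleftrightarrow> (\<exists>r::nat \<Rightarrow> nat. strict_mono r \<and> (x \<circ> r) \<longlonglongrightarrow> z)"

end

theory Submission
  imports Defs
begin

text \<open>The whole theorem rests on one inequality for a single proximal step. Let \<open>v\<close> minimise
  \<open>h y + \<parallel>u - y\<parallel>\<^sup>p / (p b)\<close> with \<open>v \<noteq> u\<close>. Comparing \<open>v\<close> with the point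
  \<open>l xbar + (1 - l) v\<close>, bounding \<open>h\<close> there by quasar-convexity, dividing by \<open>l\<close> and
  letting \<open>l\<close> tend to \<open>0\<close> from the right gives
  \<open>\<kappa> (h v - h xbar) + (\<kappa> \<gamma> / 2) \<parallel>v - xbar\<parallel>\<^sup>2 \<le> (1 / b) \<parallel>u - v\<parallel>\<^bsup>p - 2\<^esup> \<langle>u - v, v - xbar\<rangle>\<close>
  (lemma \<open>Prox_variational_inequality\<close>). Since \<open>u - v \<noteq> 0\<close>, the derivative
  of \<open>\<parallel>\<cdot>\<parallel>\<^sup>p\<close> at \<open>u - v\<close> is given by the usual formula, also when \<open>p < 2\<close>.

  The left-hand side is nonnegative, so \<open>\<langle>u - v, v - xbar\<rangle> \<ge> 0\<close>, and hence the distance to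
  \<open>xbar\<close> does not increase along the iteration. Comparing \<open>v\<close> with \<open>u\<close> itself gives
  \<open>h v + \<parallel>u - v\<parallel>\<^sup>p / (p b) \<le> h u\<close>; the function values therefore decrease strictly, and
  telescoping makes the \<open>p\<close>-th powers of the step lengths summable. In particular the steps
  tend to \<open>0\<close>. By the Cauchy--Schwarz inequality the right-hand side of the inequality above
  is at most \<open>(1 / b) \<parallel>u - v\<parallel>\<^bsup>p - 1\<^esup> \<parallel>v - xbar\<parallel>\<close>, which tends to \<open>0\<close> because \<open>b\<close> is bounded
  below and the iterates are bounded. So the function values tend to the minimum and, if
  \<open>\<gamma> > 0\<close>, the iterates tend to \<open>xbar\<close>. Lower semicontinuity puts the cluster points in
  the set of minimisers. If distances to every minimiser are nonincreasing, then a subsequence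
  converging to a minimiser forces the whole sequence to converge to it.\<close>

section \<open>Minimisers and lower semicontinuity\<close>

lemma argmin_iff: "z \<in> argmin h \<longleftrightarrow> (\<forall>y. h z \<le> h y)" for h :: "'a \<Rightarrow> ereal"
  by (auto simp: argmin_def is_arg_min_def not_less)

lemma argmin_eq_INF:
  fixes h :: "'a \<Rightarrow> ereal"
  assumes "z \<in> argmin h"
  shows "(INF y. h y) = h z"
  using assms by (intro antisym INF_lower INF_greatest) (auto simp: argmin_iff)

lemma argmin_finite:
  assumes "proper h" "z \<in> argmin h"
  shows "\<bar>h z\<bar> \<noteq> \<infinity>"
proof -
  from assms(1) obtain y where "h y < \<infinity>" by (auto simp: proper_def edom_def)
  with assms(2) have "h z < \<infinity>" by (meson argmin_iff le_less_trans)
  with assms(1) show ?thesis by (auto simp: proper_def)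
qed

lemma lsc_le_limit:
  assumes "lsc h" "y \<longlonglongrightarrow> z" "(\<lambda>n. h (y n)) \<longlonglongrightarrow> m"
  shows "h z \<le> m"
proof (rule dense_le)
  fix C assume C: "C < h z"
  with assms(1) have "C < Liminf (at z) h"
    unfolding lsc_def by (meson less_le_trans)
  then have "eventually (\<lambda>w. C < h w) (at z)"
    by (rule less_LiminfD)
  with C have "eventually (\<lambda>w. C < h w) (nhds z)"
    by (auto simp: eventually_at_filter elim: eventually_mono)
  with assms(2) have "eventually (\<lambda>n. C < h (y n)) sequentially"
    by (auto simp: filterlim_iff)
  then have "eventually (\<lambda>n. C \<le> h (y n)) sequentially"
    by (auto elim: eventually_mono)
  with assms(3) show "C \<le> m"
    by (rule tendsto_lowerbound) simp
qed

section \<open>Strong quasar-convexity\<close>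

lemma strongly_quasar_convex_argmin_unique:
  assumes sqc: "strongly_quasar_convex \<kappa> \<gamma> h xbar" and "0 < \<gamma>"
  shows "argmin h = {xbar}"
proof (intro equalityI subsetI)
  fix z assume z: "z \<in> argmin h"
  have k: "0 < \<kappa>" "\<kappa> \<le> 1" and pr: "proper h" and xb: "xbar \<in> argmin h"
    using sqc by (auto simp: strongly_quasar_convex_def)
  have eq: "h z = h xbar" using z xb by (auto simp: argmin_iff intro: antisym)
  obtain m where m: "h xbar = ereal m" using argmin_finite[OF pr xb] by auto
  have zd: "z \<in> edom h" by (simp add: edom_def eq m)
  \<comment> \<open>At the midpoint the coefficient \<open>l (1 - l / (2 - \<kappa>))\<close> is positive.\<close>
  define q where "q = 1/2 * (1 - (1/2) / (2 - \<kappa>)) * (\<kappa> * \<gamma> / 2)"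
  have q: "q > 0" unfolding q_def using k \<open>0 < \<gamma>\<close>
    by (intro mult_pos_pos) (auto simp: field_simps)
  have "h xbar \<le> h ((1/2) *\<^sub>R xbar + (1 - 1/2) *\<^sub>R z)"
    using xb by (simp add: argmin_iff)
  also have "\<dots> \<le> ereal (\<kappa> * (1/2)) * h xbar + ereal (1 - \<kappa> * (1/2)) * h z
      - ereal (q * (norm (z - xbar))\<^sup>2)"
    using sqc zd unfolding strongly_quasar_convex_def q_def
    by (elim conjE) (drule bspec, assumption, drule bspec[of _ _ "1/2"], simp_all)
  finally have "q * (norm (z - xbar))\<^sup>2 \<le> 0" by (simp add: eq m algebra_simps)
  with q have "z = xbar"
    by (simp add: mult_le_0_iff power2_eq_square)
  then show "z \<in> {xbar}" by simp
qed (use sqc in \<open>simp add: strongly_quasar_convex_def\<close>)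

section \<open>A single proximal step\<close>

lemma has_real_derivative_norm_powr_line:
  fixes w d :: "'a::real_inner"
  assumes "w \<noteq> 0"
  shows "((\<lambda>l. norm (w + l *\<^sub>R d) powr p) has_real_derivative
           p * norm w powr (p - 2) * (w \<bullet> d)) (at 0)"
proof -
  \<comment> \<open>Written through the squared norm, the function is a power of a quadratic polynomial in \<open>l\<close>.\<close>
  have sq: "norm v powr r = (v \<bullet> v) powr (r / 2)" for v :: 'a and r
    by (simp add: norm_eq_sqrt_inner powr_half_sqrt[symmetric] powr_powr)
  have pos: "w \<bullet> w > 0" using assms by simp
  have "((\<lambda>l. (w \<bullet> w + l * (2 * (w \<bullet> d)) + l\<^sup>2 * (d \<bullet> d)) powr (p / 2)) has_real_derivative
         (p / 2) * (w \<bullet> w) powr (p / 2 - 1) * (2 * (w \<bullet> d))) (at 0)"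
    using pos by (auto intro!: derivative_eq_intros)
  also have "(\<lambda>l. (w \<bullet> w + l * (2 * (w \<bullet> d)) + l\<^sup>2 * (d \<bullet> d)) powr (p / 2))
      = (\<lambda>l. norm (w + l *\<^sub>R d) powr p)"
    by (simp add: sq inner_simps power2_eq_square inner_commute algebra_simps)
  also have "(p / 2) * (w \<bullet> w) powr (p / 2 - 1) * (2 * (w \<bullet> d))
      = p * norm w powr (p - 2) * (w \<bullet> d)"
    by (simp add: sq diff_divide_distrib)
  finally show ?thesis .
qed

lemma Prox_le:
  "v \<in> Prox p b h u \<Longrightarrow>
    h v + ereal (1 / (p * b) * norm (u - v) powr p) \<le> h y + ereal (1 / (p * b) * norm (u - y) powr p)"
  unfolding Prox_def argmin_iff by blast

lemma Prox_finite:
  assumes "proper h" "v \<in> Prox p b h u"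
  shows "\<bar>h v\<bar> \<noteq> \<infinity>"
proof -
  from assms(1) obtain y where "h y < \<infinity>" by (auto simp: proper_def edom_def)
  with Prox_le[OF assms(2), of y] have "h v \<noteq> \<infinity>" by auto
  with assms(1) show ?thesis by (auto simp: proper_def)
qed

lemma Prox_variational_inequality:
  assumes sqc: "strongly_quasar_convex \<kappa> \<gamma> h xbar"
    and p: "1 < p" and b: "0 < b" and v: "v \<in> Prox p b h u" and ne: "v \<noteq> u"
  shows "\<kappa> * (real_of_ereal (h v) - real_of_ereal (h xbar)) + \<kappa> * \<gamma> / 2 * (norm (v - xbar))\<^sup>2
      \<le> 1 / b * norm (u - v) powr (p - 2) * ((u - v) \<bullet> (v - xbar))"
proof -
  have pr: "proper h" and xb: "xbar \<in> argmin h"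
    using sqc by (auto simp: strongly_quasar_convex_def)
  obtain m where m: "h xbar = ereal m" using argmin_finite[OF pr xb] by auto
  obtain a where a: "h v = ereal a" using Prox_finite[OF pr v] by auto
  have vd: "v \<in> edom h" by (simp add: edom_def a)
  define c where "c = 1 / (p * b)"
  define N where "N = (\<lambda>l. norm ((u - v) + l *\<^sub>R (v - xbar)) powr p)"
  define S where "S = (norm (v - xbar))\<^sup>2"
  have ineq: "\<kappa> * (a - m) + (1 - l / (2 - \<kappa>)) * (\<kappa> * \<gamma> / 2 * S) \<le> c * ((N l - N 0) / l)"
    if l: "0 < l" "l < 1" for l
  proof -
    define e where "e = 1 - l / (2 - \<kappa>)"
    define y where "y = l *\<^sub>R xbar + (1 - l) *\<^sub>R v"
    have uy: "u - y = (u - v) + l *\<^sub>R (v - xbar)"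
      by (simp add: y_def algebra_simps)
    have "h v + ereal (c * N 0) \<le> h y + ereal (c * N l)"
      using Prox_le[OF v, of y] by (simp add: c_def N_def uy)
    also have "h y \<le> ereal (\<kappa> * l) * h xbar + ereal (1 - \<kappa> * l) * h v
      - ereal (l * (1 - l / (2 - \<kappa>)) * (\<kappa> * \<gamma> / 2) * S)"
      using sqc vd l unfolding strongly_quasar_convex_def y_def S_def
      by (elim conjE) (drule bspec, assumption, drule bspec[of _ _ l], simp_all)
    finally have "a + c * N 0 \<le> \<kappa> * l * m + (1 - \<kappa> * l) * a
        - l * (1 - l / (2 - \<kappa>)) * (\<kappa> * \<gamma> / 2) * S + c * N l"
      by (simp add: a m add_right_mono)
    then have "l * (\<kappa> * (a - m) + e * (\<kappa> * \<gamma> / 2 * S)) \<le> c * (N l - N 0)"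
      unfolding e_def[symmetric] by (simp add: algebra_simps)
    with l show ?thesis unfolding e_def[symmetric] by (simp add: pos_le_divide_eq mult.commute)
  qed
  have "(N has_real_derivative p * norm (u - v) powr (p - 2) * ((u - v) \<bullet> (v - xbar))) (at 0)"
    unfolding N_def using ne by (intro has_real_derivative_norm_powr_line) auto
  then have "((\<lambda>l. (N l - N 0) / l) \<longlongrightarrow> p * norm (u - v) powr (p - 2) * ((u - v) \<bullet> (v - xbar)))
      (at_right 0)"
    by (auto simp: has_field_derivative_iff intro: tendsto_mono[OF at_le])
  then have R: "((\<lambda>l. c * ((N l - N 0) / l)) \<longlongrightarrow>
      c * (p * norm (u - v) powr (p - 2) * ((u - v) \<bullet> (v - xbar)))) (at_right 0)"
    by (rule tendsto_mult_left)
  have "((\<lambda>l. \<kappa> * (a - m) + (1 - l / (2 - \<kappa>)) * (\<kappa> * \<gamma> / 2 * S)) \<longlongrightarrow>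
      \<kappa> * (a - m) + (1 - 0 / (2 - \<kappa>)) * (\<kappa> * \<gamma> / 2 * S)) (at_right 0)"
    using sqc by (intro tendsto_intros) (auto simp: strongly_quasar_convex_def)
  then have "\<kappa> * (a - m) + (1 - 0 / (2 - \<kappa>)) * (\<kappa> * \<gamma> / 2 * S)
      \<le> c * (p * norm (u - v) powr (p - 2) * ((u - v) \<bullet> (v - xbar)))"
    by (rule tendsto_le[OF trivial_limit_at_right_real R])
      (unfold eventually_at_right_field, use ineq in \<open>blast intro: zero_less_one\<close>)
  then show ?thesis
    using p b by (simp add: a m S_def c_def)
qed

section \<open>Estimates along the iteration\<close>

text \<open>The standing situation: an infinite run with proximal parameters in
  \<open>[\<beta>', \<beta>'']\<close>.\<close>

locale HiPPA_run =
  fixes h :: "'a::euclidean_space \<Rightarrow> ereal" and p \<beta>' \<beta>'' :: real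
    and \<beta> :: "nat \<Rightarrow> real" and x :: "nat \<Rightarrow> 'a"
  assumes proper_h: "proper h"
    and beta_pos: "0 < \<beta>'"
    and beta_lower: "\<And>k. \<beta>' \<le> \<beta> k"
    and beta_upper: "\<And>k. \<beta> k \<le> \<beta>''"
    and p_gt_1: "1 < p"
    and run: "HiPPA p \<beta> h x"
begin

lemma beta_k_pos: "0 < \<beta> k"
  using beta_pos beta_lower[of k] by linarith

lemma step_Prox: "x (Suc k) \<in> Prox p (\<beta> k) h (x k)"
  and step_neq: "x (Suc k) \<noteq> x k"
  using run by (auto simp: HiPPA_def)

lemma value_finite: "\<bar>h (x (Suc k))\<bar> \<noteq> \<infinity>"
  using Prox_finite[OF proper_h step_Prox] .

lemma value_ge_minimum:
  assumes "z \<in> argmin h"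
  shows "real_of_ereal (h z) \<le> real_of_ereal (h (x (Suc k)))"
proof -
  have "h z \<le> h (x (Suc k))" using assms by (simp add: argmin_iff)
  then show ?thesis
    using value_finite[of k] argmin_finite[OF proper_h assms]
    by (cases "h z"; cases "h (x (Suc k))") auto
qed

lemma sufficient_decrease:
  "h (x (Suc k)) + ereal (1 / (p * \<beta> k) * norm (x (Suc k) - x k) powr p) \<le> h (x k)"
  using Prox_le[OF step_Prox, of k "x k"] by (simp add: norm_minus_commute)

lemma value_strict_decrease: "h (x (Suc k)) < h (x k)"
proof -
  have "0 < 1 / (p * \<beta> k) * norm (x (Suc k) - x k) powr p"
    using p_gt_1 beta_k_pos[of k] step_neq[of k] by simp
  moreover obtain a where "h (x (Suc k)) = ereal a" using value_finite[of k] by auto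
  ultimately show ?thesis
    using sufficient_decrease[of k] by (auto intro: less_le_trans[rotated])
qed

text \<open>The value at \<open>x 0\<close> may be infinite, so the telescoping starts at \<open>x 1\<close>.\<close>

lemma summable_steps:
  assumes "z \<in> argmin h"
  shows "summable (\<lambda>k. norm (x (Suc k) - x k) powr p)"
proof -
  define H where "H k = real_of_ereal (h (x (Suc k)))" for k
  have H: "h (x (Suc k)) = ereal (H k)" for k
    using value_finite[of k] by (auto simp: H_def)
  have "decseq H"
    using value_strict_decrease by (intro decseq_SucI less_imp_le) (metis H ereal_less(1) less_ereal.simps(1))
  moreover have "\<forall>k. real_of_ereal (h z) \<le> H k"
    using value_ge_minimum[OF assms] by (simp add: H_def)
  ultimately obtain L where "H \<longlonglongrightarrow> L" by (rule decseq_convergent)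
  then have "summable (\<lambda>k. H k - H (Suc k))"
    by (rule telescope_summable')
  then have *: "summable (\<lambda>k. (p * \<beta>'') * (H k - H (Suc k)))"
    by (rule summable_mult)
  have "norm (norm (x (Suc (Suc k)) - x (Suc k)) powr p) \<le> (p * \<beta>'') * (H k - H (Suc k))" for k
  proof -
    let ?N = "norm (x (Suc (Suc k)) - x (Suc k)) powr p"
    have *: "1 / (p * \<beta> (Suc k)) * ?N \<le> H k - H (Suc k)"
      using sufficient_decrease[of "Suc k"] by (simp add: H)
    have pos: "0 < p * \<beta> (Suc k)" using p_gt_1 beta_k_pos[of "Suc k"] by simp
    have "0 \<le> 1 / (p * \<beta> (Suc k)) * ?N" using pos by simp
    then have nn: "0 \<le> H k - H (Suc k)" using * by linarith
    have "?N \<le> p * \<beta> (Suc k) * (H k - H (Suc k))"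
      using mult_left_mono[OF *, of "p * \<beta> (Suc k)"] pos p_gt_1 beta_k_pos[of "Suc k"] by simp
    also have "\<dots> \<le> (p * \<beta>'') * (H k - H (Suc k))"
      using nn beta_upper[of "Suc k"] p_gt_1 by (intro mult_right_mono mult_left_mono) auto
    finally show ?thesis by simp
  qed
  then have "summable (\<lambda>k. norm (x (Suc (Suc k)) - x (Suc k)) powr p)"
    by (intro summable_comparison_test[OF _ *]) auto
  then show ?thesis
    by (subst (asm) summable_Suc_iff[of "\<lambda>k. norm (x (Suc k) - x k) powr p"])
qed

lemma steps_tendsto_0:
  assumes "z \<in> argmin h"
  shows "(\<lambda>k. norm (x (Suc k) - x k)) \<longlonglongrightarrow> 0"
proof -
  have "(\<lambda>k. (norm (x (Suc k) - x k) powr p) powr (1 / p)) \<longlonglongrightarrow> 0"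
    by (rule tendsto_zero_powrI[OF summable_LIMSEQ_zero[OF summable_steps[OF assms]] tendsto_const])
      (use p_gt_1 in auto)
  then show ?thesis using p_gt_1 by (simp add: powr_powr)
qed

text \<open>Here \<open>z\<close> may be any minimiser with respect to which \<open>h\<close> is strongly quasar-convex, not
  a fixed one; convergence to a single minimiser when \<open>\<gamma> = 0\<close> depends on this.\<close>

lemma Fejer_monotone:
  assumes sqc: "strongly_quasar_convex \<kappa> \<gamma> h z"
  shows "decseq (\<lambda>k. norm (x k - z))"
proof (rule decseq_SucI)
  fix k
  let ?u = "x k" and ?v = "x (Suc k)"
  have k: "0 < \<kappa>" "0 \<le> \<gamma>" and z: "z \<in> argmin h"
    using sqc by (auto simp: strongly_quasar_convex_def)
  have "0 \<le> \<kappa> * (real_of_ereal (h ?v) - real_of_ereal (h z)) + \<kappa> * \<gamma> / 2 * (norm (?v - z))\<^sup>2"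
    using k value_ge_minimum[OF z, of k] by simp
  also note Prox_variational_inequality[OF sqc p_gt_1 beta_k_pos step_Prox step_neq]
  finally have "0 \<le> (1 / \<beta> k * norm (?u - ?v) powr (p - 2)) * ((?u - ?v) \<bullet> (?v - z))" .
  moreover have "0 < 1 / \<beta> k * norm (?u - ?v) powr (p - 2)"
    using beta_k_pos[of k] step_neq[of k] by simp
  ultimately have "0 \<le> (?u - ?v) \<bullet> (?v - z)"
    by (simp only: zero_le_mult_iff) linarith
  moreover have "(norm (?u - z))\<^sup>2 = (norm (?u - ?v))\<^sup>2 + 2 * ((?u - ?v) \<bullet> (?v - z)) + (norm (?v - z))\<^sup>2"
    by (simp add: power2_norm_eq_inner inner_simps inner_commute)
  ultimately have "(norm (?v - z))\<^sup>2 \<le> (norm (?u - z))\<^sup>2" by simp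
  then show "norm (?v - z) \<le> norm (?u - z)" by (simp add: power2_le_iff_abs_le)
qed

lemma bounded_iterates:
  assumes "strongly_quasar_convex \<kappa> \<gamma> h z"
  shows "bounded (range x)"
proof -
  have "norm (x k - z) \<le> norm (x 0 - z)" for k
    using decseqD[OF Fejer_monotone[OF assms], of 0 k] by simp
  then show ?thesis
    by (auto simp: bounded_def dist_norm norm_minus_commute intro!: exI[of _ z])
qed

lemma optimality_gap_tendsto_0:
  assumes sqc: "strongly_quasar_convex \<kappa> \<gamma> h z"
  shows "(\<lambda>k. \<kappa> * (real_of_ereal (h (x (Suc k))) - real_of_ereal (h z))
            + \<kappa> * \<gamma> / 2 * (norm (x (Suc k) - z))\<^sup>2) \<longlonglongrightarrow> 0" (is "?g \<longlonglongrightarrow> 0")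
proof (rule tendsto_sandwich)
  have k: "0 < \<kappa>" "0 \<le> \<gamma>" and z: "z \<in> argmin h"
    using sqc by (auto simp: strongly_quasar_convex_def)
  with k value_ge_minimum[OF z] show "\<forall>\<^sub>F k in sequentially. 0 \<le> ?g k" by simp
  define D where "D = norm (x 0 - z)"
  have "?g k \<le> 1 / \<beta>' * norm (x (Suc k) - x k) powr (p - 1) * D" for k
  proof -
    let ?u = "x k" and ?v = "x (Suc k)"
    let ?w = "norm (?v - ?u)"
    have w: "0 < ?w" using step_neq[of k] by simp
    have "?g k \<le> 1 / \<beta> k * norm (?u - ?v) powr (p - 2) * ((?u - ?v) \<bullet> (?v - z))"
      by (rule Prox_variational_inequality[OF sqc p_gt_1 beta_k_pos step_Prox step_neq])
    also have "\<dots> \<le> 1 / \<beta> k * norm (?u - ?v) powr (p - 2) * (norm (?u - ?v) * norm (?v - z))"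
      using beta_k_pos[of k] by (intro mult_left_mono norm_cauchy_schwarz) auto
    also have "\<dots> = 1 / \<beta> k * (?w powr (p - 2) * ?w powr 1) * norm (?v - z)"
      using w by (simp add: norm_minus_commute)
    also have "\<dots> = 1 / \<beta> k * ?w powr (p - 1) * norm (?v - z)"
      unfolding powr_add[symmetric] by simp
    also have "\<dots> \<le> 1 / \<beta>' * ?w powr (p - 1) * D"
      using beta_pos beta_lower[of k] decseqD[OF Fejer_monotone[OF sqc], of 0 "Suc k"]
      by (intro mult_mono) (auto simp: D_def frac_le)
    finally show ?thesis .
  qed
  then show "\<forall>\<^sub>F k in sequentially. ?g k \<le> 1 / \<beta>' * norm (x (Suc k) - x k) powr (p - 1) * D"
    by simp
  have "(\<lambda>k. norm (x (Suc k) - x k) powr (p - 1)) \<longlonglongrightarrow> 0"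
    by (rule tendsto_zero_powrI[OF steps_tendsto_0[OF z] tendsto_const]) (use p_gt_1 in auto)
  then show "(\<lambda>k. 1 / \<beta>' * norm (x (Suc k) - x k) powr (p - 1) * D) \<longlonglongrightarrow> 0"
    using tendsto_mult_right[OF tendsto_mult_left, of _ 0 sequentially "1 / \<beta>'" D] by simp
qed simp

section \<open>Convergence\<close>

lemma values_tendsto_minimum:
  assumes sqc: "strongly_quasar_convex \<kappa> \<gamma> h z"
  shows "(\<lambda>k. h (x k)) \<longlonglongrightarrow> h z"
proof -
  have k: "0 < \<kappa>" "0 \<le> \<gamma>" and z: "z \<in> argmin h"
    using sqc by (auto simp: strongly_quasar_convex_def)
  define H where "H k = real_of_ereal (h (x (Suc k)))" for k
  have H: "h (x (Suc k)) = ereal (H k)" for k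
    using value_finite[of k] by (auto simp: H_def)
  obtain m where m: "h z = ereal m" using argmin_finite[OF proper_h z] by auto
  have ge: "m \<le> H k" for k
    using z by (metis H m argmin_iff ereal_less_eq(3))
  have "(\<lambda>k. \<kappa> * (H k - m)) \<longlonglongrightarrow> 0"
  proof (rule tendsto_sandwich[OF _ _ tendsto_const])
    show "(\<lambda>k. \<kappa> * (H k - m) + \<kappa> * \<gamma> / 2 * (norm (x (Suc k) - z))\<^sup>2) \<longlonglongrightarrow> 0"
      using optimality_gap_tendsto_0[OF sqc] by (simp add: H_def m)
    show "\<forall>\<^sub>F k in sequentially. \<kappa> * (H k - m)
        \<le> \<kappa> * (H k - m) + \<kappa> * \<gamma> / 2 * (norm (x (Suc k) - z))\<^sup>2"
      using k by simp
    show "\<forall>\<^sub>F k in sequentially. 0 \<le> \<kappa> * (H k - m)"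
      using k ge by simp
  qed
  then have "(\<lambda>k. \<kappa> * (H k - m) / \<kappa> + m) \<longlonglongrightarrow> 0 / \<kappa> + m"
    using k by (intro tendsto_intros) auto
  then have "H \<longlonglongrightarrow> m" using k by simp
  then have "(\<lambda>k. h (x (Suc k))) \<longlonglongrightarrow> h z" by (simp add: H m)
  then show ?thesis by (rule LIMSEQ_imp_Suc)
qed

lemma cluster_point_in_argmin:
  assumes sqc: "strongly_quasar_convex \<kappa> \<gamma> h xbar" and "lsc h" and "cluster_point x z"
  shows "z \<in> argmin h"
proof -
  from assms(3) obtain r :: "nat \<Rightarrow> nat" where r: "strict_mono r" "(x \<circ> r) \<longlonglongrightarrow> z"
    by (auto simp: cluster_point_def)
  have "((\<lambda>k. h (x k)) \<circ> r) \<longlonglongrightarrow> h xbar"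
    using values_tendsto_minimum[OF sqc] r(1) by (rule LIMSEQ_subseq_LIMSEQ)
  then have "h z \<le> h xbar"
    using lsc_le_limit[OF \<open>lsc h\<close> r(2)] by (simp add: comp_def)
  moreover have "xbar \<in> argmin h" using sqc by (simp add: strongly_quasar_convex_def)
  ultimately show ?thesis by (auto simp: argmin_iff intro: order_trans)
qed

lemma convergent_to_minimiser:
  assumes sqc: "strongly_quasar_convex \<kappa> \<gamma> h xbar" and "lsc h"
    and all: "\<And>z. z \<in> argmin h \<Longrightarrow> quasar_convex \<kappa> h z"
  shows "\<exists>z \<in> argmin h. x \<longlonglongrightarrow> z"
proof -
  obtain z and r :: "nat \<Rightarrow> nat" where r: "strict_mono r" "(x \<circ> r) \<longlonglongrightarrow> z"
    using bounded_imp_convergent_subsequence[OF bounded_iterates[OF sqc]] by blast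
  then have z: "z \<in> argmin h"
    using cluster_point_in_argmin[OF sqc \<open>lsc h\<close>] by (auto simp: cluster_point_def)
  have dec: "decseq (\<lambda>k. norm (x k - z))"
    using Fejer_monotone all[OF z] by (auto simp: quasar_convex_def)
  then obtain L where L: "(\<lambda>k. norm (x k - z)) \<longlonglongrightarrow> L"
    using decseq_convergent[of "\<lambda>k. norm (x k - z)" 0] by auto
  have "(\<lambda>k. norm ((x \<circ> r) k - z)) \<longlonglongrightarrow> 0"
    by (intro tendsto_norm_zero LIM_zero r(2))
  moreover have "(\<lambda>k. norm ((x \<circ> r) k - z)) \<longlonglongrightarrow> L"
    using LIMSEQ_subseq_LIMSEQ[OF L r(1)] by (simp add: comp_def)
  ultimately have "L = 0" by (rule LIMSEQ_unique[symmetric])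
  with L have "x \<longlonglongrightarrow> z"
    by (simp add: LIM_zero_iff tendsto_norm_zero_iff)
  with z show ?thesis by blast
qed

lemma convergent_if_strongly_quasar_convex:
  assumes sqc: "strongly_quasar_convex \<kappa> \<gamma> h xbar" and "0 < \<gamma>"
  shows "x \<longlonglongrightarrow> xbar"
proof -
  have k: "0 < \<kappa>" and xb: "xbar \<in> argmin h"
    using sqc by (auto simp: strongly_quasar_convex_def)
  have ge: "real_of_ereal (h xbar) \<le> real_of_ereal (h (x (Suc k)))" for k
    by (rule value_ge_minimum[OF xb])
  define C where "C = \<kappa> * \<gamma> / 2"
  have C: "0 < C" using k \<open>0 < \<gamma>\<close> by (simp add: C_def)
  have "(\<lambda>k. C * (norm (x (Suc k) - xbar))\<^sup>2) \<longlonglongrightarrow> 0"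
    by (rule tendsto_sandwich[OF _ _ tendsto_const optimality_gap_tendsto_0[OF sqc]])
      (use k ge C in \<open>auto simp: C_def\<close>)
  then have "(\<lambda>k. sqrt (C * (norm (x (Suc k) - xbar))\<^sup>2 / C)) \<longlonglongrightarrow> sqrt (0 / C)"
    using C by (intro tendsto_intros) auto
  then have "(\<lambda>k. norm (x (Suc k) - xbar)) \<longlonglongrightarrow> 0" using C by simp
  then have "(\<lambda>k. x (Suc k)) \<longlonglongrightarrow> xbar"
    by (simp add: LIM_zero_iff tendsto_norm_zero_iff)
  then show ?thesis by (rule LIMSEQ_imp_Suc)
qed

end

theorem theorem46:
  fixes h :: "real ^ 'n \<Rightarrow> ereal" and xbar :: "real ^ 'n"
    and \<kappa> \<gamma> p \<beta>' \<beta>'' :: real and \<beta> :: "nat \<Rightarrow> real" and x :: "nat \<Rightarrow> real ^ 'n"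
  assumes "0 < \<kappa>" and "\<kappa> \<le> 1" and "0 \<le> \<gamma>"
    and "proper h" and "lsc h"
    and "xbar \<in> argmin h"
    and "strongly_quasar_convex \<kappa> \<gamma> h xbar"
    and "0 < \<beta>'" and "\<forall>k. \<beta>' \<le> \<beta> k \<and> \<beta> k \<le> \<beta>''"
    and "1 < p" and "HiPPA p \<beta> h x"
  shows
    "(\<forall>k. h (x (Suc k)) < h (x k)) \<and>
     summable (\<lambda>k. norm (x (Suc k) - x k) powr p) \<and>
     (bounded (range x) \<and> decseq (\<lambda>k. norm (x k - xbar))) \<and>
     (\<lambda>k. h (x k)) \<longlonglongrightarrow> (INF y. h y) \<and>
     (\<forall>z. cluster_point x z \<longrightarrow> z \<in> argmin h) \<and>
     (\<gamma> = 0 \<and> (\<forall>z \<in> argmin h. quasar_convex \<kappa> h z) \<longrightarrow> (\<exists>z \<in> argmin h. x \<longlonglongrightarrow> z)) \<and>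
     (\<gamma> > 0 \<longrightarrow> argmin h = {xbar} \<and> x \<longlonglongrightarrow> xbar)"
proof -
  interpret HiPPA_run h p \<beta>' \<beta>'' \<beta> x
    using assms by unfold_locales auto
  note sqc = \<open>strongly_quasar_convex \<kappa> \<gamma> h xbar\<close>
  show ?thesis
    using value_strict_decrease summable_steps[OF \<open>xbar \<in> argmin h\<close>]
      bounded_iterates[OF sqc] Fejer_monotone[OF sqc]
      values_tendsto_minimum[OF sqc] argmin_eq_INF[OF \<open>xbar \<in> argmin h\<close>]
      cluster_point_in_argmin[OF sqc \<open>lsc h\<close>] convergent_to_minimiser[OF sqc \<open>lsc h\<close>]
      strongly_quasar_convex_argmin_unique[OF sqc] convergent_if_strongly_quasar_convex[OF sqc]
    by auto
qed

end
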